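(* Let $V:[0,+\infty)\to\mathbb R$ be the value function $$V(h_0)=\sup_{\ell(\cdot)\in\mathcal A}\int_0^{+\infty}e^{-\rho t}\,U\big(\ell(t),B(1-\ell(t)),h^{h_0,\ell}(t)\big)\,dt .$$ Then: (i) $V$ is negative, $V(0^+)>-\infty$, and $V$ is decreasing and continuous in $[0,+\infty)$. (ii) $V$ is a viscosity solution in $(0,+\infty)$ of the HJB equation $$\rho V(h)=\max_{\ell\in[\underline\ell,\bar\ell]}H_{CV}(\ell,h,DV(h)).$$ (iii) $V$ is locally Lipschitz in $(0,+\infty)$. (iv) $V(+\infty)=-\infty$.
   Context: Parameters: $\rho>0$, $\phi>0$, $B>0$, $\tilde B=B^{1-\sigma}$, $\sigma>1$, $\gamma<1$ with $\gamma(\sigma-1)>1$ (so $0<\gamma<1$), and $0<\underline\ell<\bar\ell<1$. Admissible controls: $\mathcal A=\{\ell\in L^1_{loc}(\mathbb R_+)\ :\ \ell(t)\in[\underline\ell,\bar\ell]\}$. For $h_0\ge 0$ and $\ell\in\mathcal A$, $h^{h_0,\ell}$ is the solution of $\dot h=\phi(\ell-h)$, $h(0)=h_0$, i.e. $h^{h_0,\ell}(t)=e^{-\phi t}\left[h_0+\phi\int_0^t e^{\phi s}\ell(s)\,ds\right]$. The utility is $$U(\ell,B(1-\ell),h)=\frac{\left(\frac{\ell}{h^\gamma}\right)^{1-\sigma}}{1-\sigma}+\tilde B\,\frac{(1-\ell)^{1-\sigma}}{1-\sigma},$$ the first term being understood as $\frac{\ell^{1-\sigma}h^{\gamma(\sigma-1)}}{1-\sigma}$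 (so it is $0$ at $h=0$). The current value Hamiltonian is $$H_{CV}(\ell,h,p)=\frac{\left(\frac{\ell}{h^\gamma}\right)^{1-\sigma}}{1-\sigma}+\tilde B\,\frac{(1-\ell)^{1-\sigma}}{1-\sigma}+p\,\phi(\ell-h).$$ $V(0^+)$ and $V(+\infty)$ denote the limits of $V(h)$ as $h\to0^+$ and $h\to+\infty$. Viscosity solution in $(0,+\infty)$: a continuous function $w$ is a viscosity subsolution if for every $C^1$ function $\psi$ and every local maximum point $h_0\in(0,+\infty)$ of $w-\psi$ one has $\rho w(h_0)\le\max_{\ell\in[\underline\ell,\bar\ell]}H_{CV}(\ell,h_0,D\psi(h_0))$; it is a viscosity supersolution if for every $C^1$ function $\psi$ and every local minimum point $h_0\in(0,+\infty)$ of $w-\psi$ one has $\rho w(h_0)\ge\max_{\ell\in[\underline\ell,\bar\ell]}H_{CV}(\ell,h_0,D\psi(h_0))$; it is a viscosity solution if it is both. *)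

theory Defs
  imports "HOL-Analysis.Analysis"
begin

text \<open>Controls are functions on the whole real line of which only the values on
  \<open>[0, \<infinity>)\<close> matter. As for elements of \<open>L\<^sup>1\<close>, measurability is Lebesgue measurability
  and the pointwise constraint is imposed almost everywhere.\<close>

definition admissible :: "real \<Rightarrow> real \<Rightarrow> (real \<Rightarrow> real) set" where
  "admissible lmin lmax =
     {l. (\<forall>T\<ge>0. set_integrable lebesgue {0..T} l) \<and>
         (AE t in lebesgue. 0 \<le> t \<longrightarrow> l t \<in> {lmin..lmax})}"

text \<open>The solution of $\dot h = \phi(l - h)$, $h(0) = h_0$, by variation of constants.\<close>

definition state :: "real \<Rightarrow> real \<Rightarrow> (real \<Rightarrow> real) \<Rightarrow> real \<Rightarrow> real" where
  "state \<phi> h\<^sub>0 l t =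
     exp (- \<phi> * t) * (h\<^sub>0 + \<phi> * (LINT s:{0..t}|lebesgue. exp (\<phi> * s) * l s))"

text \<open>\<open>utility \<sigma> \<gamma> B x h\<close> is $U(x, B(1-x), h)$. The first summand is
  $(x/h^\gamma)^{1-\sigma}/(1-\sigma)$ written so that it vanishes at \<open>h = 0\<close>
  (recall \<open>0 powr a = 0\<close>).\<close>

definition utility :: "real \<Rightarrow> real \<Rightarrow> real \<Rightarrow> real \<Rightarrow> real \<Rightarrow> real" where
  "utility \<sigma> \<gamma> B x h =
     x powr (1 - \<sigma>) * h powr (\<gamma> * (\<sigma> - 1)) / (1 - \<sigma>)
     + B powr (1 - \<sigma>) * ((1 - x) powr (1 - \<sigma>) / (1 - \<sigma>))"

definition payoff ::
  "real \<Rightarrow> real \<Rightarrow> real \<Rightarrow> real \<Rightarrow> real \<Rightarrow> real \<Rightarrow> (real \<Rightarrow> real) \<Rightarrow> real" where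
  "payoff \<rho> \<phi> B \<sigma> \<gamma> h\<^sub>0 l =
     (LINT t:{0..}|lebesgue. exp (- \<rho> * t) * utility \<sigma> \<gamma> B (l t) (state \<phi> h\<^sub>0 l t))"

text \<open>The integral and the supremum are the real-valued ones; lemmas
  \<open>payoff_integrable\<close>, \<open>bdd_above_payoff\<close> and \<open>admissible_nonempty\<close> below show that
  they are never taken outside their domain.\<close>

definition value_function ::
  "real \<Rightarrow> real \<Rightarrow> real \<Rightarrow> real \<Rightarrow> real \<Rightarrow> real \<Rightarrow> real \<Rightarrow> real \<Rightarrow> real" where
  "value_function \<rho> \<phi> B \<sigma> \<gamma> lmin lmax h\<^sub>0 =
     (SUP l\<in>admissible lmin lmax. payoff \<rho> \<phi> B \<sigma> \<gamma> h\<^sub>0 l)"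

definition H_CV ::
  "real \<Rightarrow> real \<Rightarrow> real \<Rightarrow> real \<Rightarrow> real \<Rightarrow> real \<Rightarrow> real \<Rightarrow> real" where
  "H_CV \<phi> B \<sigma> \<gamma> x h p = utility \<sigma> \<gamma> B x h + p * \<phi> * (x - h)"

text \<open>The supremum is a maximum, see \<open>max_H_CV_attained\<close> below.\<close>

definition max_H_CV ::
  "real \<Rightarrow> real \<Rightarrow> real \<Rightarrow> real \<Rightarrow> real \<Rightarrow> real \<Rightarrow> real \<Rightarrow> real \<Rightarrow> real" where
  "max_H_CV \<phi> B \<sigma> \<gamma> lmin lmax h p = (SUP x\<in>{lmin..lmax}. H_CV \<phi> B \<sigma> \<gamma> x h p)"


text \<open>Viscosity solutions of $\rho w(h) = F(h, Dw(h))$ in $(0,\infty)$. Since that interval is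
  open, it does not matter that the neighbourhoods of a point are taken in the whole line.\<close>

definition local_max_at :: "(real \<Rightarrow> real) \<Rightarrow> real \<Rightarrow> bool" where
  "local_max_at f x \<longleftrightarrow> (\<forall>\<^sub>F y in nhds x. f y \<le> f x)"

definition local_min_at :: "(real \<Rightarrow> real) \<Rightarrow> real \<Rightarrow> bool" where
  "local_min_at f x \<longleftrightarrow> (\<forall>\<^sub>F y in nhds x. f x \<le> f y)"

definition viscosity_subsolution ::
  "real \<Rightarrow> (real \<Rightarrow> real \<Rightarrow> real) \<Rightarrow> (real \<Rightarrow> real) \<Rightarrow> bool" where
  "viscosity_subsolution \<rho> F w \<longleftrightarrow>
     continuous_on {0<..} w \<and>
     (\<forall>\<psi>. \<psi> C1_differentiable_on {0<..} \<longrightarrow>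
       (\<forall>h>0. local_max_at (\<lambda>y. w y - \<psi> y) h \<longrightarrow> \<rho> * w h \<le> F h (deriv \<psi> h)))"

definition viscosity_supersolution ::
  "real \<Rightarrow> (real \<Rightarrow> real \<Rightarrow> real) \<Rightarrow> (real \<Rightarrow> real) \<Rightarrow> bool" where
  "viscosity_supersolution \<rho> F w \<longleftrightarrow>
     continuous_on {0<..} w \<and>
     (\<forall>\<psi>. \<psi> C1_differentiable_on {0<..} \<longrightarrow>
       (\<forall>h>0. local_min_at (\<lambda>y. w y - \<psi> y) h \<longrightarrow> \<rho> * w h \<ge> F h (deriv \<psi> h)))"

definition viscosity_solution ::
  "real \<Rightarrow> (real \<Rightarrow> real \<Rightarrow> real) \<Rightarrow> (real \<Rightarrow> real) \<Rightarrow> bool" where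
  "viscosity_solution \<rho> F w \<longleftrightarrow>
     viscosity_subsolution \<rho> F w \<and> viscosity_supersolution \<rho> F w"

definition locally_Lipschitz_on :: "real set \<Rightarrow> (real \<Rightarrow> real) \<Rightarrow> bool" where
  "locally_Lipschitz_on S f \<longleftrightarrow>
     (\<forall>x\<in>S. \<exists>r>0. \<exists>L. L-lipschitz_on (cball x r \<inter> S) f)"

lemma max_H_CV_attained:
  assumes "0 < lmin" "lmin \<le> lmax" "lmax < 1"
  shows "\<exists>x\<in>{lmin..lmax}. max_H_CV \<phi> B \<sigma> \<gamma> lmin lmax h p = H_CV \<phi> B \<sigma> \<gamma> x h p \<and>
           (\<forall>y\<in>{lmin..lmax}. H_CV \<phi> B \<sigma> \<gamma> y h p \<le> H_CV \<phi> B \<sigma> \<gamma> x h p)"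
proof -
  have "continuous_on {lmin..lmax} (\<lambda>x. H_CV \<phi> B \<sigma> \<gamma> x h p)"
    unfolding H_CV_def utility_def divide_inverse
    using assms by (intro continuous_intros) auto
  then obtain x where x: "x \<in> {lmin..lmax}"
      "\<forall>y\<in>{lmin..lmax}. H_CV \<phi> B \<sigma> \<gamma> y h p \<le> H_CV \<phi> B \<sigma> \<gamma> x h p"
    using continuous_attains_sup[of "{lmin..lmax}" "\<lambda>x. H_CV \<phi> B \<sigma> \<gamma> x h p"] assms by auto
  then have "max_H_CV \<phi> B \<sigma> \<gamma> lmin lmax h p = H_CV \<phi> B \<sigma> \<gamma> x h p"
    unfolding max_H_CV_def by (intro cSup_eq_maximum) auto
  with x show ?thesis by blast
qed

lemma admissible_nonempty:
  assumes "lmin \<le> lmax"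
  shows "admissible lmin lmax \<noteq> {}"
proof -
  have "(\<lambda>_. lmin) \<in> admissible lmin lmax"
    using assms by (auto simp: admissible_def absolutely_integrable_on_const)
  then show ?thesis by blast
qed

lemma control_measurable:
  assumes "l \<in> admissible lmin lmax"
  shows "(\<lambda>t. indicat_real {0..} t * l t) \<in> borel_measurable lebesgue"
proof (rule borel_measurable_LIMSEQ_metric)
  show "(\<lambda>t. indicat_real {0..real n} t * l t) \<in> borel_measurable lebesgue" for n
  proof -
    have "set_integrable lebesgue {0..real n} l" using assms by (simp add: admissible_def)
    from borel_measurable_integrable[OF this[unfolded set_integrable_def]] show ?thesis by simp
  qed
  show "(\<lambda>n. indicat_real {0..real n} t * l t) \<longlonglongrightarrow> indicat_real {0..} t * l t" for t
  proof (rule tendsto_eventually)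
    obtain N where "t \<le> real N" using real_arch_simple by blast
    then show "\<forall>\<^sub>F n in sequentially. indicat_real {0..real n} t * l t = indicat_real {0..} t * l t"
      by (intro eventually_sequentiallyI[of N]) (auto simp: indicator_def)
  qed
qed

lemma weighted_control_integrable:
  assumes "l \<in> admissible lmin lmax"
  shows "set_integrable lebesgue {0..t} (\<lambda>s. exp (\<phi> * s) * l s)"
proof (cases "0 \<le> t")
  case True
  have "(\<lambda>s. exp (\<phi> * s) * l s) absolutely_integrable_on {0..t}"
  proof (rule absolutely_integrable_bounded_measurable_product_real)
    have c: "continuous_on {0..t} (\<lambda>s. exp (\<phi> * s))" by (intro continuous_intros)
    show "(\<lambda>s. exp (\<phi> * s)) \<in> borel_measurable (lebesgue_on {0..t})"
      using c by (intro continuous_imp_measurable_on_sets_lebesgue) auto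
    show "bounded ((\<lambda>s. exp (\<phi> * s)) ` {0..t})"
      using c by (intro compact_imp_bounded compact_continuous_image) auto
    show "l absolutely_integrable_on {0..t}" using assms True by (auto simp: admissible_def)
  qed auto
  then show ?thesis .
qed (auto simp: set_integrable_def)

lemma state_continuous:
  assumes "l \<in> admissible lmin lmax"
  shows "continuous_on {0..} (state \<phi> h\<^sub>0 l)"
proof -
  define I where "I = (\<lambda>t. LINT s:{0..t}|lebesgue. exp (\<phi> * s) * l s)"
  have eq: "I t = integral {0..t} (\<lambda>s. exp (\<phi> * s) * l s)" for t
    unfolding I_def by (rule set_lebesgue_integral_eq_integral[OF weighted_control_integrable[OF assms]])
  have cont: "continuous_on {0..T} I" for T
    unfolding eq
    by (intro indefinite_integral_continuous_1 set_lebesgue_integral_eq_integral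
        weighted_control_integrable[OF assms])
  have "continuous_on {0..} I"
    unfolding continuous_on_eq_continuous_within
  proof
    fix t :: real assume t: "t \<in> {0..}"
    have "continuous (at t within {0..t + 1}) I"
      using cont[of "t + 1"] t by (auto simp: continuous_on_eq_continuous_within)
    moreover have "at t within {0..} = at t within {0..t + 1}"
      by (rule at_within_nhd[of _ "{..<t + 1}"]) (use t in auto)
    ultimately show "continuous (at t within {0..}) I" by simp
  qed
  then show ?thesis
    unfolding state_def I_def by (intro continuous_intros)
qed

lemma state_bounds:
  assumes l: "l \<in> admissible lmin lmax" and "\<phi> > 0" "0 \<le> h\<^sub>0" "0 < lmin" "lmax < 1" "0 \<le> t"
  shows "state \<phi> h\<^sub>0 l t \<in> {0..h\<^sub>0 + 1}"
proof -
  define I where "I = (LINT s:{0..t}|lebesgue. exp (\<phi> * s) * l s)"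
  have ae: "AE s in lebesgue. 0 \<le> s \<longrightarrow> l s \<in> {lmin..lmax}"
    using l by (auto simp: admissible_def)
  have "0 \<le> I"
    unfolding I_def set_lebesgue_integral_def
    by (intro integral_nonneg_AE eventually_mono[OF ae]) (use assms in \<open>auto simp: indicator_def\<close>)
  have int: "((\<lambda>s. exp (\<phi> * s)) has_integral (exp (\<phi> * t) / \<phi> - exp (\<phi> * 0) / \<phi>)) {0..t}"
    using assms
    by (intro fundamental_theorem_of_calculus)
       (auto intro!: derivative_eq_intros simp: has_real_derivative_iff_has_vector_derivative[symmetric])
  have seti: "set_integrable lebesgue {0..t} (\<lambda>s. exp (\<phi> * s))"
    using int by (intro nonnegative_absolutely_integrable_1) auto
  have "I \<le> (LINT s:{0..t}|lebesgue. exp (\<phi> * s))"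
    unfolding I_def
    by (intro set_integral_mono_AE weighted_control_integrable[OF l] seti eventually_mono[OF ae])
       (use assms in auto)
  also have "\<dots> = (exp (\<phi> * t) - 1) / \<phi>"
    using set_lebesgue_integral_eq_integral(2)[OF seti] integral_unique[OF int]
    by (simp add: diff_divide_distrib)
  finally have le: "\<phi> * I \<le> exp (\<phi> * t) - 1"
    using assms by (simp add: field_simps)
  have "state \<phi> h\<^sub>0 l t \<le> exp (- \<phi> * t) * (h\<^sub>0 + exp (\<phi> * t))"
    unfolding state_def I_def[symmetric] using le by (intro mult_left_mono) auto
  also have "\<dots> = exp (- \<phi> * t) * h\<^sub>0 + 1"
    by (simp add: algebra_simps flip: exp_add)
  also have "\<dots> \<le> h\<^sub>0 + 1"
    using assms by (auto intro!: mult_left_le_one_le)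
  finally have "state \<phi> h\<^sub>0 l t \<le> h\<^sub>0 + 1" .
  moreover have "0 \<le> state \<phi> h\<^sub>0 l t"
    unfolding state_def I_def[symmetric] using assms \<open>0 \<le> I\<close> by auto
  ultimately show ?thesis by auto
qed

lemma utility_nonpos:
  assumes "\<sigma> > 1"
  shows "utility \<sigma> \<gamma> B x h \<le> 0"
  using assms unfolding utility_def
  by (intro add_nonpos_nonpos mult_nonneg_nonpos divide_nonneg_neg) auto

lemma payoff_integrable:
  assumes l: "l \<in> admissible lmin lmax"
    and "\<rho> > 0" "\<phi> > 0" "\<sigma> > 1" "\<gamma> * (\<sigma> - 1) > 0" "0 < lmin" "lmax < 1" "0 \<le> h\<^sub>0"
  shows "set_integrable lebesgue {0..}
           (\<lambda>t. exp (- \<rho> * t) * utility \<sigma> \<gamma> B (l t) (state \<phi> h\<^sub>0 l t))"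
proof -
  define K where "K = lmin powr (1 - \<sigma>) * (h\<^sub>0 + 1) powr (\<gamma> * (\<sigma> - 1)) / (\<sigma> - 1)
     + B powr (1 - \<sigma>) * ((1 - lmax) powr (1 - \<sigma>) / (\<sigma> - 1))"
  have bd: "\<bar>utility \<sigma> \<gamma> B (l t) (state \<phi> h\<^sub>0 l t)\<bar> \<le> K"
    if t: "0 \<le> t" and lt: "l t \<in> {lmin..lmax}" for t
  proof -
    have s: "state \<phi> h\<^sub>0 l t \<in> {0..h\<^sub>0 + 1}" using state_bounds[OF l] assms t by auto
    have "- utility \<sigma> \<gamma> B (l t) (state \<phi> h\<^sub>0 l t)
        = l t powr (1 - \<sigma>) * state \<phi> h\<^sub>0 l t powr (\<gamma> * (\<sigma> - 1)) / (\<sigma> - 1)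
          + B powr (1 - \<sigma>) * ((1 - l t) powr (1 - \<sigma>) / (\<sigma> - 1))"
      using assms by (simp add: utility_def divide_simps) (simp add: algebra_simps)
    also have "\<dots> \<le> K"
      unfolding K_def using s lt assms
      by (intro add_mono divide_right_mono mult_mono mult_left_mono powr_mono2 powr_mono2') auto
    finally show ?thesis using utility_nonpos[of \<sigma> \<gamma> B "l t"] assms by auto
  qed
  have expi: "set_integrable lebesgue {0..} (\<lambda>t. exp (- \<rho> * t) * K)"
    using assms
    by (intro set_integrable_mult_left nonnegative_absolutely_integrable_1
        integrable_on_exp_minus_to_infinity) auto
  show ?thesis
  proof (rule set_integrable_bound[OF expi])
    have "(\<lambda>t. indicat_real {0..} t *\<^sub>R state \<phi> h\<^sub>0 l t) \<in> borel_measurable borel"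
      by (intro borel_measurable_continuous_on_indicator state_continuous[OF l]) auto
    then have [measurable]: "(\<lambda>t. indicat_real {0..} t * state \<phi> h\<^sub>0 l t) \<in> borel_measurable lebesgue"
      by (intro measurable_completion) simp
    note [measurable] = control_measurable[OF l]
    have [measurable]: "(\<lambda>t::real. t) \<in> borel_measurable lebesgue"
      by (intro measurable_completion) simp
    have [measurable]: "indicat_real {0::real..} \<in> borel_measurable lebesgue"
      by (intro measurable_completion borel_measurable_indicator) auto
    have "(\<lambda>t. indicat_real {0..} t *\<^sub>R (exp (- \<rho> * t) * utility \<sigma> \<gamma> B
             (indicat_real {0..} t * l t) (indicat_real {0..} t * state \<phi> h\<^sub>0 l t)))
          \<in> borel_measurable lebesgue"
      unfolding utility_def by measurable
    also have "(\<lambda>t. indicat_real {0..} t *\<^sub>R (exp (- \<rho> * t) * utility \<sigma> \<gamma> B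
             (indicat_real {0..} t * l t) (indicat_real {0..} t * state \<phi> h\<^sub>0 l t)))
         = (\<lambda>t. indicat_real {0..} t *\<^sub>R
             (exp (- \<rho> * t) * utility \<sigma> \<gamma> B (l t) (state \<phi> h\<^sub>0 l t)))"
      by (auto simp: indicator_def fun_eq_iff)
    finally show "set_borel_measurable lebesgue {0..}
        (\<lambda>t. exp (- \<rho> * t) * utility \<sigma> \<gamma> B (l t) (state \<phi> h\<^sub>0 l t))"
      unfolding set_borel_measurable_def .
    have ae: "AE s in lebesgue. 0 \<le> s \<longrightarrow> l s \<in> {lmin..lmax}"
      using l by (auto simp: admissible_def)
    show "AE t in lebesgue. t \<in> {0..} \<longrightarrow>
        norm (exp (- \<rho> * t) * utility \<sigma> \<gamma> B (l t) (state \<phi> h\<^sub>0 l t)) \<le> norm (exp (- \<rho> * t) * K)"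
      by (rule eventually_mono[OF ae])
         (auto simp: abs_mult intro!: mult_left_mono order_trans[OF bd])
  qed
qed

lemma bdd_above_payoff:
  assumes "\<sigma> > 1"
  shows "bdd_above (payoff \<rho> \<phi> B \<sigma> \<gamma> h\<^sub>0 ` S)"
proof (rule bdd_aboveI2)
  show "payoff \<rho> \<phi> B \<sigma> \<gamma> h\<^sub>0 l \<le> 0" for l
  proof -
    have "0 \<le> (LINT t|lebesgue. - (indicat_real {0..} t *\<^sub>R
        (exp (- \<rho> * t) * utility \<sigma> \<gamma> B (l t) (state \<phi> h\<^sub>0 l t))))"
      using utility_nonpos[OF assms]
      by (intro Bochner_Integration.integral_nonneg)
         (auto simp: indicator_def mult_nonneg_nonpos)
    then show ?thesis
      unfolding payoff_def set_lebesgue_integral_def by simp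
  qed
qed

end

theory Submission
  imports Defs
begin

text \<open>
  Write \<open>a = \<gamma> (\<sigma> - 1) > 1\<close>. For a fixed control the state at time \<open>t\<close> depends on the initial
  value only through the summand \<open>exp (- \<phi> t) h\<close>, and the utility depends on the state through a
  negative multiple of \<open>h powr a\<close>, with a factor bounded above and below by positive constants
  because controls stay in \<open>{lmin..lmax}\<close>. So every comparison of payoffs for two initial values
  is a pointwise comparison of powers, uniform in the control, and survives the supremum.
  Superadditivity of the power gives the quantitative decrease
  \<open>V h' + k (h' - h) powr a \<le> V h\<close> for \<open>h \<le> h'\<close>, with \<open>k > 0\<close> (\<open>value_gap\<close>), which contains both
  strict monotonicity and the limit at infinity (take \<open>h = 0\<close>). As \<open>a > 1\<close>, the power is Lipschitz
  on bounded sets up to and including \<open>0\<close>, hence so is \<open>V\<close> (\<open>value_lipschitz_on\<close>); this yields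
  continuity on the closed half-line and the finite limit at \<open>0\<close>. Negativity comes from the
  second summand of the utility, which is bounded away from \<open>0\<close>.

  The HJB equation is the infinitesimal form of the dynamic programming principle
  \<open>V h = sup (running payoff on [0,\<tau>] + exp (- \<rho> \<tau>) V (X \<tau>))\<close>, whose two halves are
  \<open>dynamic_programming_le\<close> and \<open>dynamic_programming_ge\<close>. If \<open>\<psi>\<close> touches \<open>V\<close> at \<open>h\<close>, the increment
  of \<open>V\<close> is compared with \<open>\<psi>' h (X \<tau> - h)\<close> up to \<open>o(\<tau>)\<close>. The running payoff plus this term is
  the integral over \<open>[0,\<tau>]\<close> of a function that differs from the Hamiltonian
  \<open>H (l t) h (\<psi>' h)\<close> by at most a constant times \<open>\<tau>\<close>, with a constant that does not depend on the
  control (\<open>growth_integrand_near_hamiltonian\<close>). Dividing by \<open>\<tau>\<close> and letting \<open>\<tau>\<close> tend to \<open>0\<close> gives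
  the two viscosity inequalities: near-optimal controls for the subsolution, constant controls for
  the supersolution. Since the displacement \<open>X \<tau> - h\<close> is itself an explicit integral, only the
  derivative of \<open>\<psi>\<close> at the single point \<open>h\<close> enters, and no chain rule along merely absolutely
  continuous trajectories has to be invoked.
\<close>

section \<open>Powers and exponentials\<close>

text \<open>Each of the parts \<open>u = x\<close> and \<open>u = y - x\<close> of \<open>y\<close> satisfies \<open>u powr a \<le> u * y powr (a - 1)\<close>, and the right-hand sides add up to \<open>y powr a\<close>.\<close>

lemma powr_superadditive:
  fixes x y a :: real
  assumes "0 \<le> x" "x \<le> y" "1 \<le> a"
  shows "(y - x) powr a \<le> y powr a - x powr a"
proof -
  have base: "u powr a \<le> u * y powr (a - 1)" if "0 \<le> u" "u \<le> y" for u
  proof -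
    have "u powr a = u * u powr (a - 1)"
      using powr_mult_base[of u "a - 1"] that by simp
    also have "\<dots> \<le> u * y powr (a - 1)"
      using that assms by (intro mult_left_mono powr_mono2) auto
    finally show ?thesis .
  qed
  have "y powr a = y * y powr (a - 1)"
    using powr_mult_base[of y "a - 1"] assms by simp
  with base[of x] base[of "y - x"] assms show ?thesis
    by (simp add: algebra_simps)
qed

lemma powr_lipschitz:
  fixes x y a R :: real
  assumes "0 \<le> x" "x \<le> R" "0 \<le> y" "y \<le> R" "1 \<le> a"
  shows "\<bar>x powr a - y powr a\<bar> \<le> a * R powr (a - 1) * \<bar>x - y\<bar>"
proof -
  have *: "\<bar>u powr a - v powr a\<bar> \<le> a * R powr (a - 1) * \<bar>u - v\<bar>"
    if uv: "0 \<le> u" "u < v" "v \<le> R" for u v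
  proof -
    have mono: "u powr a \<le> v powr a" using uv assms by (intro powr_mono2) auto
    have "v powr a - u powr a \<le> a * R powr (a - 1) * (v - u)"
      \<comment> \<open>At \<open>0\<close> the mean value theorem is unavailable, as \<open>powr\<close> is not differentiable there.\<close>
    proof (cases "u = 0")
      case True
      have "v powr a = v powr (a - 1) * v"
        using powr_mult_base[of v "a - 1"] uv by (simp add: mult.commute)
      also have "\<dots> \<le> (a * R powr (a - 1)) * v"
      proof (intro mult_right_mono)
        have "v powr (a - 1) \<le> R powr (a - 1)" using uv assms by (intro powr_mono2) auto
        also have "\<dots> \<le> a * R powr (a - 1)" using assms by (simp add: mult_le_cancel_right1)
        finally show "v powr (a - 1) \<le> a * R powr (a - 1)" .
      qed (use uv in auto)
      finally show ?thesis using True assms by simp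
    next
      case False
      have "\<exists>z>u. z < v \<and> v powr a - u powr a = (v - u) * (a * z powr (a - 1))"
        using uv False by (intro MVT2) (auto intro!: derivative_eq_intros)
      then obtain z where z: "u < z" "z < v"
        "v powr a - u powr a = (v - u) * (a * z powr (a - 1))" by blast
      show ?thesis unfolding z(3) mult.commute[of "v - u"]
        using z uv assms by (intro mult_right_mono mult_left_mono powr_mono2) auto
    qed
    with mono uv show ?thesis by simp
  qed
  show ?thesis
    using *[of x y] *[of y x] assms by (cases x y rule: linorder_cases) (auto simp: abs_minus_commute)
qed

lemma one_minus_exp_minus_bounds:
  fixes y :: real
  assumes "0 \<le> y"
  shows "0 \<le> 1 - exp (- y)" "1 - exp (- y) \<le> y" "y - y\<^sup>2 \<le> 1 - exp (- y)"
proof -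
  show "0 \<le> 1 - exp (- y)" using assms by simp
  show "1 - exp (- y) \<le> y" using exp_ge_add_one_self[of "- y"] by simp
  have "1 \<le> (1 - y + y\<^sup>2) * (1 + y)"
    using assms by (simp add: algebra_simps power2_eq_square)
  also have "\<dots> \<le> (1 - y + y\<^sup>2) * exp y"
  proof (intro mult_left_mono exp_ge_add_one_self)
    have "0 \<le> (1 - y)\<^sup>2 + y" using assms by (intro add_nonneg_nonneg) auto
    then show "0 \<le> 1 - y + y\<^sup>2" by (simp add: power2_eq_square algebra_simps)
  qed
  finally have "exp (- y) \<le> 1 - y + y\<^sup>2"
    by (simp add: exp_minus field_simps)
  then show "y - y\<^sup>2 \<le> 1 - exp (- y)" by simp
qed

section \<open>Lebesgue integrals on the line\<close>

lemma set_lebesgue_integral_translation: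
  fixes f :: "real \<Rightarrow> real"
  shows "(LINT t:S|lebesgue. f t) = (LINT t:{t. c + t \<in> S}|lebesgue. f (c + t))"
  unfolding set_lebesgue_integral_def
  by (subst lebesgue_integral_real_affine[where c = 1 and t = c])
     (auto intro!: Bochner_Integration.integral_cong simp: indicator_def)

lemma translation_measurable_lebesgue [measurable]:
  "(\<lambda>t. c + t) \<in> lebesgue \<rightarrow>\<^sub>M (lebesgue :: real measure)"
  using lebesgue_affine_measurable[of "\<lambda>_::real. 1" c] by simp

lemma AE_lebesgue_translation:
  fixes c :: real
  assumes "AE t in lebesgue. P t"
  shows "AE t in lebesgue. P (c + t)"
proof -
  have "lebesgue = density (distr lebesgue lebesgue (\<lambda>x. c + x)) (\<lambda>_. 1)"
    using lebesgue_real_affine[of 1 c] by simp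
  then have "lebesgue = distr lebesgue lebesgue (\<lambda>x. c + x)"
    by (simp add: density_1)
  then have "AE t in distr lebesgue lebesgue (\<lambda>x. c + x). P t"
    using assms by metis
  from AE_distrD[OF translation_measurable_lebesgue this] show ?thesis .
qed

lemma AE_lebesgue_neq: "AE t in lebesgue. t \<noteq> (c :: real)"
  by (intro AE_completion AE_lborel_singleton)

lemma set_lebesgue_integral_cong_except:
  fixes f g :: "real \<Rightarrow> real"
  assumes "set_integrable lebesgue S f" "set_integrable lebesgue S g"
    and "\<And>t. t \<in> S \<Longrightarrow> t \<noteq> c \<Longrightarrow> f t = g t"
  shows "(LINT t:S|lebesgue. f t) = (LINT t:S|lebesgue. g t)"
  unfolding set_lebesgue_integral_def
proof (rule integral_cong_AE)
  show "AE t in lebesgue. indicat_real S t *\<^sub>R f t = indicat_real S t *\<^sub>R g t"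
    using AE_lebesgue_neq[of c] by eventually_elim (use assms(3) in \<open>auto simp: indicator_def\<close>)
qed (use assms(1,2) in \<open>auto simp: set_integrable_def dest: borel_measurable_integrable\<close>)

lemma set_lebesgue_integral_split:
  fixes f :: "real \<Rightarrow> real"
  assumes "set_integrable lebesgue (S \<union> T) f" "S \<in> sets lebesgue" "T \<in> sets lebesgue"
    and "S \<inter> T \<subseteq> {c}"
  shows "(LINT t:S \<union> T|lebesgue. f t) = (LINT t:S|lebesgue. f t) + (LINT t:T|lebesgue. f t)"
proof (rule set_integral_Un_AE)
  show "AE t in lebesgue. \<not> (t \<in> S \<and> t \<in> T)"
    using AE_lebesgue_neq[of c] by eventually_elim (use assms(4) in auto)
  show "set_integrable lebesgue S f" "set_integrable lebesgue T f"
    using assms by (auto intro: set_integrable_subset)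
qed (use assms in auto)

lemma set_lebesgue_integral_exp:
  fixes c :: real
  assumes "c > 0"
  shows "set_integrable lebesgue {0..} (\<lambda>t. exp (- c * t))"
    and "(LINT t:{0..}|lebesgue. exp (- c * t)) = 1 / c"
proof -
  show *: "set_integrable lebesgue {0..} (\<lambda>t. exp (- c * t))"
    using assms
    by (intro nonnegative_absolutely_integrable_1 integrable_on_exp_minus_to_infinity) auto
  show "(LINT t:{0..}|lebesgue. exp (- c * t)) = 1 / c"
    using set_lebesgue_integral_eq_integral(2)[OF *]
      integral_unique[OF has_integral_exp_minus_to_infinity[OF assms, of 0]] by simp
qed

section \<open>Controls and trajectories\<close>

text \<open>Local integrability follows from the bounds, so measurability is all that has to be checked for shifted and concatenated controls.\<close>

lemma admissibleI:
  assumes meas: "(\<lambda>t. indicat_real {0..} t * l t) \<in> borel_measurable lebesgue"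
    and ae: "AE t in lebesgue. 0 \<le> t \<longrightarrow> l t \<in> {lmin..lmax}"
  shows "l \<in> admissible lmin lmax"
  unfolding admissible_def
proof (intro CollectI conjI allI impI ae)
  fix T :: real
  have [measurable]: "indicat_real {0..T} \<in> borel_measurable lebesgue"
    by (intro measurable_completion borel_measurable_indicator) auto
  have "set_integrable lebesgue {0..T} (\<lambda>_. \<bar>lmin\<bar> + \<bar>lmax\<bar>)"
    by (simp add: absolutely_integrable_on_const)
  then show "set_integrable lebesgue {0..T} l"
  proof (rule set_integrable_bound)
    have "(\<lambda>t. indicat_real {0..T} t * (indicat_real {0..} t * l t)) \<in> borel_measurable lebesgue"
      using meas by measurable
    also have "(\<lambda>t. indicat_real {0..T} t * (indicat_real {0..} t * l t))
        = (\<lambda>t. indicat_real {0..T} t *\<^sub>R l t)"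
      by (auto simp: indicator_def fun_eq_iff)
    finally show "set_borel_measurable lebesgue {0..T} l"
      unfolding set_borel_measurable_def .
    show "AE t in lebesgue. t \<in> {0..T} \<longrightarrow> norm (l t) \<le> norm (\<bar>lmin\<bar> + \<bar>lmax\<bar>)"
      using ae by eventually_elim auto
  qed
qed

definition concat_control :: "real \<Rightarrow> (real \<Rightarrow> real) \<Rightarrow> (real \<Rightarrow> real) \<Rightarrow> real \<Rightarrow> real" where
  "concat_control \<tau> l m t = (if t < \<tau> then l t else m (t - \<tau>))"

lemma admissible_translation:
  assumes l: "l \<in> admissible lmin lmax" and "0 \<le> \<tau>"
  shows "(\<lambda>t. l (\<tau> + t)) \<in> admissible lmin lmax"
proof (rule admissibleI)
  have [measurable]: "indicat_real {0::real..} \<in> borel_measurable lebesgue"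
    by (intro measurable_completion borel_measurable_indicator) auto
  have "(\<lambda>t. indicat_real {0..} t * (\<lambda>u. indicat_real {0..} u * l u) (\<tau> + t)) \<in> borel_measurable lebesgue"
    by (intro borel_measurable_times measurable_compose[OF translation_measurable_lebesgue
          control_measurable[OF l]]) measurable
  also have "(\<lambda>t. indicat_real {0..} t * (\<lambda>u. indicat_real {0..} u * l u) (\<tau> + t))
      = (\<lambda>t. indicat_real {0..} t * l (\<tau> + t))"
    using assms by (auto simp: indicator_def fun_eq_iff)
  finally show "(\<lambda>t. indicat_real {0..} t * l (\<tau> + t)) \<in> borel_measurable lebesgue" .
  have "AE t in lebesgue. 0 \<le> t \<longrightarrow> l t \<in> {lmin..lmax}" using l by (simp add: admissible_def)
  from AE_lebesgue_translation[OF this, of \<tau>]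
  show "AE t in lebesgue. 0 \<le> t \<longrightarrow> l (\<tau> + t) \<in> {lmin..lmax}"
    by eventually_elim (use assms in auto)
qed

lemma admissible_concat:
  assumes l: "l \<in> admissible lmin lmax" and m: "m \<in> admissible lmin lmax" and "0 \<le> \<tau>"
  shows "concat_control \<tau> l m \<in> admissible lmin lmax"
proof (rule admissibleI)
  have m': "(\<lambda>t. (\<lambda>u. indicat_real {0..} u * m u) (- \<tau> + t)) \<in> borel_measurable lebesgue"
    by (rule measurable_compose[OF translation_measurable_lebesgue control_measurable[OF m]])
  have [measurable]: "Measurable.pred lebesgue (\<lambda>t::real. t < \<tau>)"
    by (intro measurable_completion) simp
  have "(\<lambda>t. if t < \<tau> then indicat_real {0..} t * l t
          else (\<lambda>u. indicat_real {0..} u * m u) (- \<tau> + t)) \<in> borel_measurable lebesgue"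
    by (intro measurable_If m' control_measurable[OF l]) measurable
  also have "(\<lambda>t. if t < \<tau> then indicat_real {0..} t * l t
          else (\<lambda>u. indicat_real {0..} u * m u) (- \<tau> + t))
      = (\<lambda>t. indicat_real {0..} t * concat_control \<tau> l m t)"
    using assms by (auto simp: indicator_def fun_eq_iff concat_control_def)
  finally show "(\<lambda>t. indicat_real {0..} t * concat_control \<tau> l m t) \<in> borel_measurable lebesgue" .
  have "AE t in lebesgue. 0 \<le> t \<longrightarrow> l t \<in> {lmin..lmax}"
    and "AE t in lebesgue. 0 \<le> t \<longrightarrow> m t \<in> {lmin..lmax}"
    using l m by (simp_all add: admissible_def)
  from this(1) AE_lebesgue_translation[OF this(2), of "- \<tau>"]
  show "AE t in lebesgue. 0 \<le> t \<longrightarrow> concat_control \<tau> l m t \<in> {lmin..lmax}"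
    by eventually_elim (auto simp: concat_control_def)
qed

lemma state_diff: "state \<phi> h' l t - state \<phi> h l t = exp (- \<phi> * t) * (h' - h)"
  by (simp add: state_def algebra_simps)

text \<open>The semigroup property of the controlled flow: restarting from the state reached at time \<open>\<tau>\<close> with the remaining control continues the same trajectory.\<close>

lemma state_translation:
  assumes l: "l \<in> admissible lmin lmax" and "0 \<le> \<tau>" "0 \<le> t"
  shows "state \<phi> h l (\<tau> + t) = state \<phi> (state \<phi> h l \<tau>) (\<lambda>s. l (\<tau> + s)) t"
proof -
  have un: "{0..\<tau> + t} = {0..\<tau>} \<union> {\<tau>..\<tau> + t}" using assms by auto
  have "(LINT s:{0..\<tau> + t}|lebesgue. exp (\<phi> * s) * l s)
      = (LINT s:{0..\<tau>}|lebesgue. exp (\<phi> * s) * l s) + (LINT s:{\<tau>..\<tau> + t}|lebesgue. exp (\<phi> * s) * l s)"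
    unfolding un
    by (rule set_lebesgue_integral_split[where c = \<tau>])
       (use weighted_control_integrable[OF l, of "\<tau> + t"] in \<open>auto simp flip: un\<close>)
  also have "(LINT s:{\<tau>..\<tau> + t}|lebesgue. exp (\<phi> * s) * l s)
      = (LINT s:{0..t}|lebesgue. exp (\<phi> * \<tau>) * (exp (\<phi> * s) * l (\<tau> + s)))"
    by (subst set_lebesgue_integral_translation[where c = \<tau>])
       (simp add: distrib_left exp_add mult.assoc atLeastAtMost_def atLeast_def atMost_def Collect_conj_eq)
  also have "\<dots> = exp (\<phi> * \<tau>) * (LINT s:{0..t}|lebesgue. exp (\<phi> * s) * l (\<tau> + s))"
    by simp
  finally have split: "(LINT s:{0..\<tau> + t}|lebesgue. exp (\<phi> * s) * l s)
      = (LINT s:{0..\<tau>}|lebesgue. exp (\<phi> * s) * l s)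
        + exp (\<phi> * \<tau>) * (LINT s:{0..t}|lebesgue. exp (\<phi> * s) * l (\<tau> + s))" .
  have "exp (- \<phi> * (\<tau> + t)) = exp (- \<phi> * \<tau>) * exp (- \<phi> * t)"
    and "exp (- \<phi> * \<tau>) * exp (\<phi> * \<tau>) = 1"
    by (simp_all add: distrib_left flip: exp_add)
  with split show ?thesis unfolding state_def by algebra
qed

lemma state_concat:
  assumes l: "l \<in> admissible lmin lmax" and m: "m \<in> admissible lmin lmax"
    and "0 \<le> \<tau>" "t \<le> \<tau>"
  shows "state \<phi> h (concat_control \<tau> l m) t = state \<phi> h l t"
proof -
  have "(LINT s:{0..t}|lebesgue. exp (\<phi> * s) * concat_control \<tau> l m s)
      = (LINT s:{0..t}|lebesgue. exp (\<phi> * s) * l s)"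
    by (rule set_lebesgue_integral_cong_except[where c = \<tau>])
       (use assms weighted_control_integrable[OF l]
          weighted_control_integrable[OF admissible_concat[OF l m]]
        in \<open>auto simp: concat_control_def\<close>)
  then show ?thesis by (simp add: state_def)
qed

text \<open>The integrated equation with the integrating factor \<open>exp (\<phi> s)\<close>, that is, variation of
  constants around the rest point \<open>h\<close>. It makes the displacement linear in the control, without
  the trajectory appearing under the integral.\<close>

lemma state_displacement:
  assumes l: "l \<in> admissible lmin lmax" and "\<phi> > 0" "0 \<le> t"
  shows "set_integrable lebesgue {0..t} (\<lambda>s. exp (- \<phi> * (t - s)) * (l s - h))"
    and "state \<phi> h l t - h = \<phi> * (LINT s:{0..t}|lebesgue. exp (- \<phi> * (t - s)) * (l s - h))"
proof -
  \<comment> \<open>A constant is an admissible control for degenerate bounds, which provides its integrability.\<close>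
  have c: "(\<lambda>_. h) \<in> admissible h h"
    by (rule admissibleI) (auto intro!: borel_measurable_times measurable_completion)
  note int = weighted_control_integrable[OF l, of t \<phi>] weighted_control_integrable[OF c, of t \<phi>]
  have eq: "exp (- \<phi> * (t - s)) * (l s - h)
      = exp (- \<phi> * t) * (exp (\<phi> * s) * l s - exp (\<phi> * s) * h)" for s
    by (simp add: algebra_simps flip: exp_add)
  show "set_integrable lebesgue {0..t} (\<lambda>s. exp (- \<phi> * (t - s)) * (l s - h))"
    unfolding eq using int by (intro set_integrable_mult_right set_integral_diff)
  have "((\<lambda>s. exp (\<phi> * s)) has_integral (exp (\<phi> * t) / \<phi> - exp (\<phi> * 0) / \<phi>)) {0..t}"
    using assms
    by (intro fundamental_theorem_of_calculus)
       (auto intro!: derivative_eq_intros simp: has_real_derivative_iff_has_vector_derivative[symmetric])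
  then have "integral {0..t} (\<lambda>s. exp (\<phi> * s) * h) = (exp (\<phi> * t) - 1) / \<phi> * h"
    by (simp add: integral_unique diff_divide_distrib)
  then have "(LINT s:{0..t}|lebesgue. exp (\<phi> * s) * h) = (exp (\<phi> * t) - 1) / \<phi> * h"
    using set_lebesgue_integral_eq_integral(2)[OF int(2)] by simp
  then show "state \<phi> h l t - h = \<phi> * (LINT s:{0..t}|lebesgue. exp (- \<phi> * (t - s)) * (l s - h))"
    unfolding eq using int assms
    by (simp add: set_integral_diff state_def field_simps exp_minus)
qed


section \<open>Estimates for the utility\<close>

locale habit_model =
  fixes \<rho> \<phi> B \<sigma> \<gamma> lmin lmax :: real
  assumes rho: "\<rho> > 0" and phi: "\<phi> > 0" and B: "B > 0" and sigma: "\<sigma> > 1"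
    and exponent: "\<gamma> * (\<sigma> - 1) > 1"
    and lmin: "0 < lmin" and lmin_le_lmax: "lmin \<le> lmax" and lmax: "lmax < 1"
begin

abbreviation "a \<equiv> \<gamma> * (\<sigma> - 1)"
abbreviation "A \<equiv> admissible lmin lmax"
abbreviation "U \<equiv> utility \<sigma> \<gamma> B"
abbreviation "X \<equiv> state \<phi>"
abbreviation "J \<equiv> payoff \<rho> \<phi> B \<sigma> \<gamma>"
abbreviation "V \<equiv> value_function \<rho> \<phi> B \<sigma> \<gamma> lmin lmax"
abbreviation "H \<equiv> H_CV \<phi> B \<sigma> \<gamma>"
abbreviation "discounted_utility h l t \<equiv> exp (- \<rho> * t) * U (l t) (X h l t)"
abbreviation "running_payoff h l \<tau> \<equiv> (LINT t:{0..\<tau>}|lebesgue. discounted_utility h l t)"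

lemma admissible_AE: "l \<in> A \<Longrightarrow> AE t in lebesgue. 0 \<le> t \<longrightarrow> l t \<in> {lmin..lmax}"
  by (simp add: admissible_def)

lemma state_nonneg: "l \<in> A \<Longrightarrow> 0 \<le> h \<Longrightarrow> 0 \<le> t \<Longrightarrow> 0 \<le> X h l t"
  using state_bounds[of l lmin lmax \<phi> h t] phi lmin lmax by auto

lemma state_le: "l \<in> A \<Longrightarrow> 0 \<le> h \<Longrightarrow> 0 \<le> t \<Longrightarrow> X h l t \<le> h + 1"
  using state_bounds[of l lmin lmax \<phi> h t] phi lmin lmax by auto

lemma discounted_utility_integrable:
  "l \<in> A \<Longrightarrow> 0 \<le> h \<Longrightarrow> set_integrable lebesgue {0..} (discounted_utility h l)"
  using payoff_integrable[of l lmin lmax \<rho> \<phi> \<sigma> \<gamma> h B] rho phi sigma exponent lmin lmax by auto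

lemma discounted_utility_integrable_Icc:
  "l \<in> A \<Longrightarrow> 0 \<le> h \<Longrightarrow> set_integrable lebesgue {0..\<tau>} (discounted_utility h l)"
  by (rule set_integrable_subset[OF discounted_utility_integrable]) auto

lemma utility_eq:
  "U x h = - (x powr (1 - \<sigma>) * h powr a / (\<sigma> - 1)) - B powr (1 - \<sigma>) * (1 - x) powr (1 - \<sigma>) / (\<sigma> - 1)"
  using sigma by (simp add: utility_def divide_simps) (simp add: algebra_simps)

lemma utility_upper:
  assumes "0 < x" "x < 1"
  shows "U x h \<le> - (B powr (1 - \<sigma>) / (\<sigma> - 1))"
proof -
  have "1 powr (1 - \<sigma>) \<le> (1 - x) powr (1 - \<sigma>)"
    using assms sigma by (intro powr_mono2') auto
  then have "B powr (1 - \<sigma>) * 1 / (\<sigma> - 1) \<le> B powr (1 - \<sigma>) * (1 - x) powr (1 - \<sigma>) / (\<sigma> - 1)"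
    using sigma by (intro divide_right_mono mult_left_mono) auto
  moreover have "0 \<le> x powr (1 - \<sigma>) * h powr a / (\<sigma> - 1)" using sigma by simp
  ultimately show ?thesis unfolding utility_eq by simp
qed

text \<open>The modulus of the utility at the worst control in both summands and the largest state \<open>R\<close>.\<close>

definition utility_bound :: "real \<Rightarrow> real" where
  "utility_bound R = lmin powr (1 - \<sigma>) * R powr a / (\<sigma> - 1)
     + B powr (1 - \<sigma>) * (1 - lmax) powr (1 - \<sigma>) / (\<sigma> - 1)"

lemma utility_abs_le:
  assumes "x \<in> {lmin..lmax}" "0 \<le> h" "h \<le> R"
  shows "\<bar>U x h\<bar> \<le> utility_bound R"
proof -
  have "x powr (1 - \<sigma>) * h powr a \<le> lmin powr (1 - \<sigma>) * R powr a"
    using assms sigma exponent lmin by (intro mult_mono powr_mono2 powr_mono2') auto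
  moreover have "B powr (1 - \<sigma>) * (1 - x) powr (1 - \<sigma>)
      \<le> B powr (1 - \<sigma>) * (1 - lmax) powr (1 - \<sigma>)"
    using assms sigma lmax by (intro mult_left_mono powr_mono2') auto
  ultimately have "- U x h \<le> utility_bound R"
    unfolding utility_eq utility_bound_def
    using sigma by (simp only: minus_diff_eq minus_minus diff_minus_eq_add add.commute)
      (simp add: add_mono divide_right_mono flip: add_divide_distrib)
  then show ?thesis using utility_nonpos[OF sigma, of \<gamma> B x h] by simp
qed

lemma decay_pos: "0 < \<rho> + a * \<phi>"
  by (rule add_pos_pos[OF rho mult_pos_pos[OF order.strict_trans[OF zero_less_one exponent] phi]])

text \<open>The smallest weight that an admissible control puts on \<open>h powr a\<close>; as \<open>1 - \<sigma> < 0\<close>, it is attained at \<open>lmax\<close>.\<close>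

definition state_cost :: real where "state_cost = lmax powr (1 - \<sigma>) / (\<sigma> - 1)"

lemma state_cost_pos: "0 < state_cost"
  unfolding state_cost_def using sigma lmin lmin_le_lmax by simp

lemma utility_gap:
  assumes "x \<in> {lmin..lmax}" "0 \<le> h" "h \<le> h'"
  shows "U x h' + state_cost * (h' - h) powr a \<le> U x h"
proof -
  have "lmax powr (1 - \<sigma>) / (\<sigma> - 1) * (h' - h) powr a
      \<le> x powr (1 - \<sigma>) / (\<sigma> - 1) * (h' powr a - h powr a)"
    using assms sigma exponent lmin
    by (intro mult_mono divide_right_mono powr_mono2' powr_superadditive) auto
  then show ?thesis unfolding utility_eq state_cost_def
    by (simp add: algebra_simps diff_divide_distrib)
qed

text \<open>The largest weight on \<open>h powr a\<close>, attained at \<open>lmin\<close>, times the Lipschitz constant of the power on \<open>{0..R}\<close>.\<close>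

definition utility_lip :: "real \<Rightarrow> real" where
  "utility_lip R = lmin powr (1 - \<sigma>) / (\<sigma> - 1) * (a * R powr (a - 1))"

lemma utility_lip_nonneg: "0 \<le> utility_lip R"
  unfolding utility_lip_def using sigma less_imp_le[OF order.strict_trans[OF zero_less_one exponent]]
  by (intro mult_nonneg_nonneg[OF _ mult_nonneg_nonneg]) auto

lemma utility_lipschitz:
  assumes "x \<in> {lmin..lmax}" "0 \<le> h" "h \<le> R" "0 \<le> h'" "h' \<le> R"
  shows "\<bar>U x h - U x h'\<bar> \<le> utility_lip R * \<bar>h - h'\<bar>"
proof -
  have "\<bar>U x h - U x h'\<bar> = x powr (1 - \<sigma>) / (\<sigma> - 1) * \<bar>h powr a - h' powr a\<bar>"
  proof -
    have "U x h - U x h' = - (x powr (1 - \<sigma>) / (\<sigma> - 1) * (h powr a - h' powr a))"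
      unfolding utility_eq by (simp add: algebra_simps diff_divide_distrib)
    then show ?thesis using sigma by (simp add: abs_mult)
  qed
  also have "\<dots> \<le> lmin powr (1 - \<sigma>) / (\<sigma> - 1) * (a * R powr (a - 1) * \<bar>h - h'\<bar>)"
    using assms sigma exponent lmin
    by (intro mult_mono divide_right_mono powr_mono2' powr_lipschitz) auto
  finally show ?thesis unfolding utility_lip_def by (simp only: mult.assoc)
qed

section \<open>Sign, monotonicity and regularity of the value function\<close>

lemma payoff_le_value: "l \<in> A \<Longrightarrow> J h l \<le> V h"
  unfolding value_function_def by (intro cSUP_upper bdd_above_payoff sigma)

lemma value_least: "(\<And>l. l \<in> A \<Longrightarrow> J h l \<le> c) \<Longrightarrow> V h \<le> c"
  unfolding value_function_def using lmin_le_lmax by (intro cSUP_least admissible_nonempty)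

lemma near_optimal_control:
  assumes "0 < e"
  shows "\<exists>l\<in>A. V h - e < J h l"
  using value_least[of h "V h - e"] assms by force

text \<open>The summand with \<open>1 - l\<close> alone costs at least \<open>B powr (1 - \<sigma>) / (\<sigma> - 1)\<close> per unit of undiscounted time, because \<open>1 - l < 1\<close>.\<close>

lemma payoff_le:
  assumes "l \<in> A" "0 \<le> h"
  shows "J h l \<le> - (B powr (1 - \<sigma>) / (\<sigma> - 1) / \<rho>)"
proof -
  have "J h l \<le> (LINT t:{0..}|lebesgue. exp (- \<rho> * t) * - (B powr (1 - \<sigma>) / (\<sigma> - 1)))"
    unfolding payoff_def
  proof (rule set_integral_mono_AE[OF discounted_utility_integrable[OF assms]])
    show "set_integrable lebesgue {0..} (\<lambda>t. exp (- \<rho> * t) * - (B powr (1 - \<sigma>) / (\<sigma> - 1)))"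
      by (intro set_integrable_mult_left set_lebesgue_integral_exp rho)
    show "AE t\<in>{0..} in lebesgue. discounted_utility h l t
        \<le> exp (- \<rho> * t) * - (B powr (1 - \<sigma>) / (\<sigma> - 1))"
      using admissible_AE[OF assms(1)]
    proof eventually_elim
      case (elim t)
      then show ?case using lmin lmax by (intro impI mult_left_mono utility_upper) auto
    qed
  qed
  also have "\<dots> = 1 / \<rho> * - (B powr (1 - \<sigma>) / (\<sigma> - 1))"
    by (subst set_integral_mult_left) (simp only: set_lebesgue_integral_exp(2)[OF rho])
  finally show ?thesis by (simp add: mult.commute)
qed

lemma value_negative:
  assumes "0 \<le> h"
  shows "V h < 0"
proof -
  have "V h \<le> - (B powr (1 - \<sigma>) / (\<sigma> - 1) / \<rho>)"
    using payoff_le assms by (intro value_least)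
  also have "\<dots> < 0" using B sigma rho by simp
  finally show ?thesis .
qed

text \<open>Under a common control the distance of the two trajectories is \<open>exp (- \<phi> t) (h' - h)\<close>, so the
  pointwise utility gap decays like \<open>exp (- a \<phi> t)\<close>; discounting it yields the factor
  \<open>1 / (\<rho> + a \<phi>)\<close>.\<close>

lemma payoff_gap:
  assumes l: "l \<in> A" and h: "0 \<le> h" "h \<le> h'"
  shows "J h' l + state_cost / (\<rho> + a * \<phi>) * (h' - h) powr a \<le> J h l"
proof -
  define r where "r = \<rho> + a * \<phi>"
  have r: "r > 0" unfolding r_def by (rule decay_pos)
  define K where "K = state_cost * (h' - h) powr a"
  have i1: "set_integrable lebesgue {0..} (discounted_utility h' l)" using l h by (intro discounted_utility_integrable) auto
  have i2: "set_integrable lebesgue {0..} (\<lambda>t. exp (- r * t) * K)"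
    by (intro set_integrable_mult_left set_lebesgue_integral_exp r)
  have "J h' l + 1 / r * K
      = (LINT t:{0..}|lebesgue. discounted_utility h' l t + exp (- r * t) * K)"
    using set_integral_add(2)[OF i1 i2] set_lebesgue_integral_exp(2)[OF r]
    by (simp add: payoff_def)
  also have "\<dots> \<le> J h l"
    unfolding payoff_def
  proof (rule set_integral_mono_AE)
    show "AE t\<in>{0..} in lebesgue. discounted_utility h' l t + exp (- r * t) * K \<le> discounted_utility h l t"
      using admissible_AE[OF l]
    proof eventually_elim
      case (elim t)
      show ?case
      proof
        assume t: "t \<in> {0..}"
        have gap: "X h' l t - X h l t = exp (- \<phi> * t) * (h' - h)" by (rule state_diff)
        have "0 \<le> X h' l t - X h l t" unfolding gap using h by simp
        then have "X h l t \<le> X h' l t" by simp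
        then have "U (l t) (X h' l t) + state_cost * (X h' l t - X h l t) powr a \<le> U (l t) (X h l t)"
          using elim t l h by (intro utility_gap state_nonneg) auto
        moreover have "(X h' l t - X h l t) powr a = exp (- (a * \<phi>) * t) * (h' - h) powr a"
          unfolding gap using h
          by (subst powr_mult) (simp_all only: exp_powr_real mult_ac mult_minus_left mult_minus_right
              exp_ge_zero diff_ge_0_iff_ge)
        ultimately have "exp (- \<rho> * t) * (U (l t) (X h' l t)
            + state_cost * (exp (- (a * \<phi>) * t) * (h' - h) powr a)) \<le> discounted_utility h l t"
          by (intro mult_left_mono) auto
        moreover have "exp (- r * t) = exp (- \<rho> * t) * exp (- (a * \<phi>) * t)"
          unfolding r_def by (simp add: algebra_simps flip: exp_add)
        ultimately show "discounted_utility h' l t + exp (- r * t) * K \<le> discounted_utility h l t"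
          unfolding K_def by (simp add: algebra_simps)
      qed
    qed
  qed (use i1 i2 l h discounted_utility_integrable in auto)
  finally show ?thesis unfolding K_def r_def by (simp add: field_simps)
qed

lemma value_gap:
  assumes h: "0 \<le> h" "h \<le> h'"
  shows "V h' + state_cost / (\<rho> + a * \<phi>) * (h' - h) powr a \<le> V h"
proof -
  have "V h' \<le> V h - state_cost / (\<rho> + a * \<phi>) * (h' - h) powr a"
    using payoff_gap[OF _ h] payoff_le_value[of _ h] by (intro value_least) (fastforce simp: le_diff_eq)
  then show ?thesis by simp
qed

lemma gap_constant_pos: "0 < state_cost / (\<rho> + a * \<phi>)"
  by (rule divide_pos_pos[OF state_cost_pos decay_pos])

lemma value_strict_antimono: "strict_antimono_on {0..} V"
proof (rule monotone_onI)
  fix h h' :: real assume "h \<in> {0..}" "h' \<in> {0..}" "h < h'"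
  moreover from this have "0 < state_cost / (\<rho> + a * \<phi>) * (h' - h) powr a"
    using gap_constant_pos by (intro mult_pos_pos) auto
  ultimately show "V h' < V h" using value_gap[of h h'] by simp
qed

lemma value_at_top: "filterlim V at_bot at_top"
proof -
  define k where "k = state_cost / (\<rho> + a * \<phi>)"
  have "filterlim (\<lambda>h::real. h powr a) at_top at_top"
    using exponent by (intro real_powr_at_top) simp
  then have "filterlim (\<lambda>h::real. k * h powr a) at_top at_top"
    using gap_constant_pos unfolding k_def
    by (intro filterlim_tendsto_pos_mult_at_top[OF tendsto_const])
  then have "filterlim (\<lambda>h. - V 0 + k * h powr a) at_top at_top"
    by (rule filterlim_tendsto_add_at_top[OF tendsto_const])
  then have "filterlim (\<lambda>h. - V h) at_top at_top"
  proof (rule filterlim_at_top_mono)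
    show "\<forall>\<^sub>F h in at_top. - V 0 + k * h powr a \<le> - V h"
      using eventually_ge_at_top[of 0]
      by eventually_elim (use value_gap[of 0] in \<open>force simp: k_def\<close>)
  qed
  then show ?thesis by (simp add: filterlim_uminus_at_bot)
qed

text \<open>Trajectories that start in \<open>{0..R}\<close> stay in \<open>{0..R + 1}\<close>, whence the constant at \<open>R + 1\<close>.\<close>

lemma payoff_lipschitz:
  assumes l: "l \<in> A" and h: "0 \<le> h" "h \<le> R" "0 \<le> h'" "h' \<le> R"
  shows "J h l \<le> J h' l + utility_lip (R + 1) / \<rho> * \<bar>h - h'\<bar>"
proof -
  define L where "L = utility_lip (R + 1) * \<bar>h - h'\<bar>"
  have i1: "set_integrable lebesgue {0..} (discounted_utility h' l)" using l h by (intro discounted_utility_integrable) auto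
  have i2: "set_integrable lebesgue {0..} (\<lambda>t. exp (- \<rho> * t) * L)"
    by (intro set_integrable_mult_left set_lebesgue_integral_exp rho)
  have "J h l \<le> (LINT t:{0..}|lebesgue. discounted_utility h' l t + exp (- \<rho> * t) * L)"
    unfolding payoff_def
  proof (rule set_integral_mono_AE)
    show "AE t\<in>{0..} in lebesgue. discounted_utility h l t \<le> discounted_utility h' l t + exp (- \<rho> * t) * L"
      using admissible_AE[OF l]
    proof eventually_elim
      case (elim t)
      show ?case
      proof
        assume t: "t \<in> {0..}"
        have "\<bar>U (l t) (X h l t) - U (l t) (X h' l t)\<bar> \<le> utility_lip (R + 1) * \<bar>X h l t - X h' l t\<bar>"
          using elim t l h state_le[OF l, of h t] state_le[OF l, of h' t]
          by (intro utility_lipschitz state_nonneg) auto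
        also have "\<dots> \<le> L"
          unfolding state_diff L_def using phi t
          by (intro mult_left_mono utility_lip_nonneg) (auto simp: abs_mult intro!: mult_left_le_one_le)
        finally have "exp (- \<rho> * t) * U (l t) (X h l t) \<le> exp (- \<rho> * t) * (U (l t) (X h' l t) + L)"
          by (intro mult_left_mono) auto
        then show "discounted_utility h l t \<le> discounted_utility h' l t + exp (- \<rho> * t) * L"
          by (simp add: distrib_left)
      qed
    qed
  qed (use i1 i2 l h discounted_utility_integrable in auto)
  also have "\<dots> = J h' l + 1 / \<rho> * L"
    using set_integral_add(2)[OF i1 i2] set_lebesgue_integral_exp(2)[OF rho]
    by (simp add: payoff_def)
  finally show ?thesis unfolding L_def by (simp add: field_simps)
qed

lemma value_lipschitz_on: "(utility_lip (R + 1) / \<rho>)-lipschitz_on {0..R} V"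
proof (rule lipschitz_onI)
  have *: "V h \<le> V h' + utility_lip (R + 1) / \<rho> * \<bar>h - h'\<bar>"
    if "h \<in> {0..R}" "h' \<in> {0..R}" for h h'
  proof (rule value_least)
    fix l assume "l \<in> A"
    then show "J h l \<le> V h' + utility_lip (R + 1) / \<rho> * \<bar>h - h'\<bar>"
      using payoff_lipschitz[of l h R h'] payoff_le_value[of l h'] that by auto
  qed
  show "dist (V h) (V h') \<le> utility_lip (R + 1) / \<rho> * dist h h'"
    if "h \<in> {0..R}" "h' \<in> {0..R}" for h h'
    using *[of h h'] *[of h' h] that by (auto simp: dist_real_def abs_minus_commute)
  show "0 \<le> utility_lip (R + 1) / \<rho>" using utility_lip_nonneg rho by simp
qed

lemma value_continuous: "continuous_on {0..} V"
  unfolding continuous_on_eq_continuous_within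
proof
  fix h :: real assume h: "h \<in> {0..}"
  have "continuous_on {0..h + 1} V"
    by (rule lipschitz_on_continuous_on[OF value_lipschitz_on])
  then have "continuous (at h within {0..h + 1}) V"
    using h by (auto simp: continuous_on_eq_continuous_within)
  moreover have "at h within {0..} = at h within {0..h + 1}"
    by (rule at_within_nhd[of _ "{..<h + 1}"]) (use h in auto)
  ultimately show "continuous (at h within {0..}) V" by simp
qed

lemma value_limit_at_zero: "(V \<longlongrightarrow> V 0) (at_right 0)"
proof (rule tendsto_mono)
  show "at_right 0 \<le> at (0::real) within {0..}" by (intro at_le) auto
  show "(V \<longlongrightarrow> V 0) (at 0 within {0..})"
    using value_continuous by (auto simp: continuous_on_def)
qed

lemma value_locally_lipschitz: "locally_Lipschitz_on {0<..} V"
  unfolding locally_Lipschitz_on_def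
proof
  fix h :: real assume "h \<in> {0<..}"
  have "cball h 1 \<inter> {0<..} \<subseteq> {0..h + 1}" by (auto simp: dist_real_def)
  then show "\<exists>r>0. \<exists>L. L-lipschitz_on (cball h r \<inter> {0<..}) V"
    using lipschitz_on_subset[OF value_lipschitz_on] by (intro exI[of _ 1]) auto
qed

section \<open>Dynamic programming\<close>

lemma payoff_split:
  assumes l: "l \<in> A" and "0 \<le> h" and \<tau>: "0 \<le> \<tau>"
  shows "J h l = running_payoff h l \<tau> + exp (- \<rho> * \<tau>) * J (X h l \<tau>) (\<lambda>t. l (\<tau> + t))"
proof -
  have un: "{0..} = {0..\<tau>} \<union> {\<tau>..}" using \<tau> by auto
  have "J h l = running_payoff h l \<tau> + (LINT t:{\<tau>..}|lebesgue. discounted_utility h l t)"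
    unfolding payoff_def un
    by (rule set_lebesgue_integral_split[where c = \<tau>])
       (use discounted_utility_integrable[OF assms(1,2)] un in auto)
  also have "(LINT t:{\<tau>..}|lebesgue. discounted_utility h l t)
      = (LINT t:{0..}|lebesgue. discounted_utility h l (\<tau> + t))"
    by (subst set_lebesgue_integral_translation[where c = \<tau>]) (simp add: atLeast_def)
  also have "\<dots> = (LINT t:{0..}|lebesgue. exp (- \<rho> * \<tau>) *
      discounted_utility (X h l \<tau>) (\<lambda>t. l (\<tau> + t)) t)"
    by (rule set_lebesgue_integral_cong)
       (use state_translation[OF l \<tau>] in \<open>auto simp: distrib_left exp_diff exp_minus divide_simps exp_add\<close>)
  finally show ?thesis by (simp add: payoff_def)
qed

lemma dynamic_programming_le:
  assumes l: "l \<in> A" and "0 \<le> h" "0 \<le> \<tau>"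
  shows "J h l \<le> running_payoff h l \<tau> + exp (- \<rho> * \<tau>) * V (X h l \<tau>)"
  unfolding payoff_split[OF assms]
  by (intro add_left_mono mult_left_mono payoff_le_value admissible_translation) (use assms in auto)

text \<open>Following \<open>l\<close> up to time \<open>\<tau>\<close> and then an arbitrary control \<open>m\<close> is admissible from \<open>h\<close>; the supremum over \<open>m\<close> turns the remaining payoff into the value at the state reached.\<close>

lemma dynamic_programming_ge:
  assumes l: "l \<in> A" and h: "0 \<le> h" and \<tau>: "0 \<le> \<tau>"
  shows "running_payoff h l \<tau> + exp (- \<rho> * \<tau>) * V (X h l \<tau>) \<le> V h"
proof -
  have "V (X h l \<tau>) \<le> (V h - running_payoff h l \<tau>) / exp (- \<rho> * \<tau>)"
  proof (rule value_least)
    fix m assume m: "m \<in> A"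
    define k where "k = concat_control \<tau> l m"
    have k: "k \<in> A" unfolding k_def by (rule admissible_concat[OF l m \<tau>])
    have "running_payoff h k \<tau> = running_payoff h l \<tau>"
      by (rule set_lebesgue_integral_cong_except[where c = \<tau>])
         (use discounted_utility_integrable_Icc[OF k h] discounted_utility_integrable_Icc[OF l h] state_concat[OF l m \<tau>]
           in \<open>auto simp: k_def concat_control_def\<close>)
    moreover have "X h k \<tau> = X h l \<tau>"
      unfolding k_def by (rule state_concat[OF l m \<tau> order_refl])
    moreover have "J (X h l \<tau>) (\<lambda>t. k (\<tau> + t)) = J (X h l \<tau>) m"
      unfolding payoff_def state_def
      by (intro set_lebesgue_integral_cong allI impI arg_cong2[where f = "(*)"]
           arg_cong2[where f = "(+)"] arg_cong2[where f = U] set_lebesgue_integral_cong refl)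
         (auto simp: k_def concat_control_def)
    ultimately have "J h k = running_payoff h l \<tau> + exp (- \<rho> * \<tau>) * J (X h l \<tau>) m"
      using payoff_split[OF k h \<tau>] by simp
    then show "J (X h l \<tau>) m \<le> (V h - running_payoff h l \<tau>) / exp (- \<rho> * \<tau>)"
      using payoff_le_value[OF k, of h] by (simp add: field_simps)
  qed
  then show ?thesis by (simp add: field_simps)
qed

section \<open>Short-time expansion\<close>

lemma displacement_integrand_le:
  assumes "x \<in> {lmin..lmax}" "0 \<le> h"
  shows "\<bar>x - h\<bar> \<le> h + 1"
  using assms lmin lmax by auto

lemma state_displacement_le:
  assumes l: "l \<in> A" and h: "0 \<le> h" and t: "0 \<le> t"
  shows "\<bar>X h l t - h\<bar> \<le> \<phi> * (h + 1) * t"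
proof -
  note int = state_displacement(1)[OF l phi t, of h]
  have ae: "AE s\<in>{0..t} in lebesgue. \<bar>exp (- \<phi> * (t - s)) * (l s - h)\<bar> \<le> h + 1"
    using admissible_AE[OF l]
  proof eventually_elim
    case (elim s)
    show ?case
    proof
      assume "s \<in> {0..t}"
      with elim have "\<bar>exp (- \<phi> * (t - s)) * (l s - h)\<bar> \<le> 1 * (h + 1)"
        unfolding abs_mult using phi h
        by (intro mult_mono displacement_integrand_le) auto
      then show "\<bar>exp (- \<phi> * (t - s)) * (l s - h)\<bar> \<le> h + 1" by simp
    qed
  qed
  have const: "set_integrable lebesgue {0..t} (\<lambda>_. h + 1)"
    by (simp add: absolutely_integrable_on_const)
  have "\<bar>LINT s:{0..t}|lebesgue. exp (- \<phi> * (t - s)) * (l s - h)\<bar>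
      \<le> (LINT s:{0..t}|lebesgue. \<bar>exp (- \<phi> * (t - s)) * (l s - h)\<bar>)"
    using set_integral_norm_bound[OF int] by simp
  also have "\<dots> \<le> (LINT s:{0..t}|lebesgue. h + 1)"
    by (rule set_integral_mono_AE[OF set_integrable_abs[OF int] const ae])
  also have "\<dots> = (h + 1) * t"
    using t by (simp add: set_lebesgue_integral_def)
  finally show ?thesis
    unfolding state_displacement(2)[OF l phi t] abs_mult using phi
    by (simp add: mult_left_mono mult.assoc)
qed

text \<open>The density whose integral over \<open>[0,\<tau>]\<close> is the running payoff plus
  \<open>exp (- \<rho> \<tau>) p (X \<tau> - h)\<close>; the displacement is written as an integral with the kernel
  \<open>\<phi> exp (- \<phi> (\<tau> - t))\<close>. At \<open>\<tau> = t = 0\<close> it is the Hamiltonian.\<close>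

definition growth_integrand :: "real \<Rightarrow> real \<Rightarrow> (real \<Rightarrow> real) \<Rightarrow> real \<Rightarrow> real \<Rightarrow> real" where
  "growth_integrand h p l \<tau> t = discounted_utility h l t
     + exp (- \<rho> * \<tau>) * p * \<phi> * (exp (- \<phi> * (\<tau> - t)) * (l t - h))"

lemma growth_integral:
  assumes l: "l \<in> A" and h: "0 \<le> h" and \<tau>: "0 \<le> \<tau>"
  shows "set_integrable lebesgue {0..\<tau>} (growth_integrand h p l \<tau>)"
    and "(LINT t:{0..\<tau>}|lebesgue. growth_integrand h p l \<tau> t)
      = running_payoff h l \<tau> + exp (- \<rho> * \<tau>) * p * (X h l \<tau> - h)"
proof -
  note i1 = discounted_utility_integrable_Icc[OF l h, of \<tau>]
  note i2 = set_integrable_mult_right[OF state_displacement(1)[OF l phi \<tau>, of h],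
      of "exp (- \<rho> * \<tau>) * p * \<phi>"]
  show "set_integrable lebesgue {0..\<tau>} (growth_integrand h p l \<tau>)"
    unfolding growth_integrand_def by (rule set_integral_add(1)[OF i1 i2])
  show "(LINT t:{0..\<tau>}|lebesgue. growth_integrand h p l \<tau> t)
      = running_payoff h l \<tau> + exp (- \<rho> * \<tau>) * p * (X h l \<tau> - h)"
    unfolding growth_integrand_def state_displacement(2)[OF l phi \<tau>, of h]
    by (subst set_integral_add(2)[OF i1 i2]) (simp add: mult.assoc)
qed

text \<open>The three summands bound, per unit of \<open>\<tau>\<close>, the effect of the moving state on the utility, of
  discounting the utility, and of the two exponential factors in front of \<open>p\<close>. What matters is that
  the control does not occur.\<close>

definition short_time_error :: "real \<Rightarrow> real \<Rightarrow> real" where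
  "short_time_error h p = utility_lip (h + 1) * (\<phi> * (h + 1)) + \<rho> * utility_bound (h + 1)
     + \<bar>p\<bar> * \<phi> * ((\<rho> + \<phi>) * (h + 1))"

lemma short_time_error_nonneg:
  assumes "0 \<le> h"
  shows "0 \<le> short_time_error h p"
proof -
  have "0 \<le> utility_bound (h + 1)"
    using utility_abs_le[of lmin h "h + 1"] assms lmin_le_lmax by auto
  then show ?thesis
    unfolding short_time_error_def using assms rho phi utility_lip_nonneg[of "h + 1"]
    by (intro add_nonneg_nonneg mult_nonneg_nonneg) auto
qed

lemma growth_integrand_near_hamiltonian:
  assumes l: "l \<in> A" and h: "0 \<le> h" and t: "0 \<le> t" "t \<le> \<tau>" and lt: "l t \<in> {lmin..lmax}"
  shows "\<bar>growth_integrand h p l \<tau> t - H (l t) h p\<bar> \<le> short_time_error h p * \<tau>"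
proof -
  define x where "x = l t"
  define y where "y = (\<rho> + \<phi>) * \<tau> - \<phi> * t"
  have \<tau>: "0 \<le> \<tau>" using t by simp
  have y: "0 \<le> y" "y \<le> (\<rho> + \<phi>) * \<tau>"
  proof -
    have "y = \<rho> * \<tau> + \<phi> * (\<tau> - t)" by (simp add: y_def algebra_simps)
    then show "0 \<le> y" using rho phi t by simp
    show "y \<le> (\<rho> + \<phi>) * \<tau>" using phi t by (simp add: y_def)
  qed
  have "growth_integrand h p l \<tau> t - H (l t) h p
      = exp (- (\<rho> * t)) * (U x (X h l t) - U x h) - (1 - exp (- (\<rho> * t))) * U x h
        - p * \<phi> * ((1 - exp (- y)) * (x - h))"
  proof -
    have "exp (- y) = exp (- \<rho> * \<tau>) * exp (- \<phi> * (\<tau> - t))"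
      by (simp add: y_def algebra_simps flip: exp_add)
    then show ?thesis
      by (simp add: growth_integrand_def H_CV_def x_def algebra_simps)
  qed
  also have "\<bar>\<dots>\<bar> \<le> \<bar>exp (- (\<rho> * t)) * (U x (X h l t) - U x h)\<bar>
      + \<bar>(1 - exp (- (\<rho> * t))) * U x h\<bar> + \<bar>p * \<phi> * ((1 - exp (- y)) * (x - h))\<bar>"
    by linarith
  also have "\<dots> \<le> utility_lip (h + 1) * (\<phi> * (h + 1)) * \<tau> + \<rho> * utility_bound (h + 1) * \<tau>
      + \<bar>p\<bar> * \<phi> * ((\<rho> + \<phi>) * (h + 1)) * \<tau>"
  proof (intro add_mono)
    have "\<bar>U x (X h l t) - U x h\<bar> \<le> utility_lip (h + 1) * \<bar>X h l t - h\<bar>"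
      unfolding x_def using lt h t state_le[OF l h] by (intro utility_lipschitz state_nonneg l) auto
    also have "\<dots> \<le> utility_lip (h + 1) * (\<phi> * (h + 1) * t)"
      by (intro mult_left_mono state_displacement_le l h t utility_lip_nonneg)
    also have "\<dots> \<le> utility_lip (h + 1) * (\<phi> * (h + 1) * \<tau>)"
      using phi h t by (intro mult_left_mono utility_lip_nonneg) auto
    finally have "exp (- (\<rho> * t)) * \<bar>U x (X h l t) - U x h\<bar> \<le> 1 * (utility_lip (h + 1) * (\<phi> * (h + 1) * \<tau>))"
      using rho t by (intro mult_mono) auto
    then show "\<bar>exp (- (\<rho> * t)) * (U x (X h l t) - U x h)\<bar> \<le> utility_lip (h + 1) * (\<phi> * (h + 1)) * \<tau>"
      by (simp add: abs_mult mult.assoc)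
    have rt: "0 \<le> \<rho> * t" "\<rho> * t \<le> \<rho> * \<tau>" using rho t by auto
    have "(1 - exp (- (\<rho> * t))) * \<bar>U x h\<bar> \<le> (\<rho> * \<tau>) * utility_bound (h + 1)"
      using one_minus_exp_minus_bounds[OF rt(1)] rt lt h unfolding x_def
      by (intro mult_mono utility_abs_le) auto
    then show "\<bar>(1 - exp (- (\<rho> * t))) * U x h\<bar> \<le> \<rho> * utility_bound (h + 1) * \<tau>"
      using one_minus_exp_minus_bounds(1)[OF rt(1)] by (simp add: abs_mult mult_ac)
    have "(1 - exp (- y)) * \<bar>x - h\<bar> \<le> ((\<rho> + \<phi>) * \<tau>) * (h + 1)"
      using one_minus_exp_minus_bounds[OF y(1)] y lt h unfolding x_def
      by (intro mult_mono displacement_integrand_le) auto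
    then have "\<bar>p\<bar> * \<phi> * ((1 - exp (- y)) * \<bar>x - h\<bar>) \<le> \<bar>p\<bar> * \<phi> * (((\<rho> + \<phi>) * \<tau>) * (h + 1))"
      using phi by (intro mult_left_mono) auto
    then show "\<bar>p * \<phi> * ((1 - exp (- y)) * (x - h))\<bar> \<le> \<bar>p\<bar> * \<phi> * ((\<rho> + \<phi>) * (h + 1)) * \<tau>"
      using one_minus_exp_minus_bounds(1)[OF y(1)] phi by (simp add: abs_mult mult_ac)
  qed
  also have "\<dots> = short_time_error h p * \<tau>"
    by (simp add: short_time_error_def algebra_simps)
  finally show ?thesis .
qed

lemma short_time_upper:
  assumes l: "l \<in> A" and h: "0 \<le> h" and \<tau>: "0 \<le> \<tau>"
    and M: "\<And>x. x \<in> {lmin..lmax} \<Longrightarrow> H x h p \<le> M"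
  shows "running_payoff h l \<tau> + exp (- \<rho> * \<tau>) * p * (X h l \<tau> - h)
    \<le> (M + short_time_error h p * \<tau>) * \<tau>"
proof -
  have "(LINT t:{0..\<tau>}|lebesgue. growth_integrand h p l \<tau> t)
      \<le> (LINT t:{0..\<tau>}|lebesgue. M + short_time_error h p * \<tau>)"
  proof (rule set_integral_mono_AE[OF growth_integral(1)[OF l h \<tau>]])
    show "AE t\<in>{0..\<tau>} in lebesgue. growth_integrand h p l \<tau> t \<le> M + short_time_error h p * \<tau>"
      using admissible_AE[OF l]
    proof eventually_elim
      case (elim t)
      then show ?case
        using growth_integrand_near_hamiltonian[OF l h, of t \<tau> p] M[of "l t"] by fastforce
    qed
  qed (simp add: absolutely_integrable_on_const)
  also have "\<dots> = (M + short_time_error h p * \<tau>) * \<tau>"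
    using \<tau> by (simp add: set_lebesgue_integral_def)
  finally show ?thesis unfolding growth_integral(2)[OF l h \<tau>] .
qed

lemma short_time_lower:
  assumes x: "x \<in> {lmin..lmax}" and l: "(\<lambda>_. x) \<in> A" and h: "0 \<le> h" and \<tau>: "0 \<le> \<tau>"
  shows "(H x h p - short_time_error h p * \<tau>) * \<tau>
    \<le> running_payoff h (\<lambda>_. x) \<tau> + exp (- \<rho> * \<tau>) * p * (X h (\<lambda>_. x) \<tau> - h)"
proof -
  have "(H x h p - short_time_error h p * \<tau>) * \<tau>
      = (LINT t:{0..\<tau>}|lebesgue. H x h p - short_time_error h p * \<tau>)"
    using \<tau> by (simp add: set_lebesgue_integral_def)
  also have "\<dots> \<le> (LINT t:{0..\<tau>}|lebesgue. growth_integrand h p (\<lambda>_. x) \<tau> t)"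
  proof (rule set_integral_mono[OF _ growth_integral(1)[OF l h \<tau>]])
    show "H x h p - short_time_error h p * \<tau> \<le> growth_integrand h p (\<lambda>_. x) \<tau> t"
      if "t \<in> {0..\<tau>}" for t
      using growth_integrand_near_hamiltonian[OF l h, of t \<tau> p] x that by fastforce
  qed (simp add: absolutely_integrable_on_const)
  finally show ?thesis unfolding growth_integral(2)[OF l h \<tau>] .
qed

lemma constant_admissible: "x \<in> {lmin..lmax} \<Longrightarrow> (\<lambda>_. x) \<in> A"
  by (auto simp: admissible_def absolutely_integrable_on_const)

text \<open>Trajectories move with speed at most \<open>\<phi> (h + 1)\<close>, whatever the control. So a property that
  holds near \<open>h\<close>, and the first-order expansion of the test function, hold along all trajectories
  up to a common time \<open>\<tau>0\<close>.\<close>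

lemma touching_neighbourhood:
  assumes "(\<psi> has_real_derivative p) (at h)" "0 \<le> h" "0 < e" "\<forall>\<^sub>F y in nhds h. P y"
  shows "\<exists>\<tau>0>0. \<forall>\<tau> l. 0 \<le> \<tau> \<longrightarrow> \<tau> \<le> \<tau>0 \<longrightarrow> l \<in> A \<longrightarrow>
     P (X h l \<tau>) \<and> \<bar>\<psi> (X h l \<tau>) - \<psi> h - p * (X h l \<tau> - h)\<bar> \<le> e * \<tau>"
proof -
  define K where "K = \<phi> * (h + 1)"
  have K: "0 < K" unfolding K_def using phi assms(2) by simp
  obtain d1 where d1: "0 < d1" "\<And>y. \<bar>y - h\<bar> < d1 \<Longrightarrow> \<bar>\<psi> y - \<psi> h - p * (y - h)\<bar> \<le> e / K * \<bar>y - h\<bar>"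
    using assms(1,3) K unfolding has_field_derivative_def has_derivative_at_alt
    by (metis divide_pos_pos real_norm_def)
  obtain d2 where d2: "0 < d2" "\<And>y. \<bar>y - h\<bar> < d2 \<Longrightarrow> P y"
    using assms(4) unfolding eventually_nhds_metric dist_real_def by auto
  define \<tau>0 where "\<tau>0 = min d1 d2 / (2 * K)"
  have "P (X h l \<tau>) \<and> \<bar>\<psi> (X h l \<tau>) - \<psi> h - p * (X h l \<tau> - h)\<bar> \<le> e * \<tau>"
    if "0 \<le> \<tau>" "\<tau> \<le> \<tau>0" "l \<in> A" for \<tau> l
  proof -
    have disp: "\<bar>X h l \<tau> - h\<bar> \<le> K * \<tau>"
      unfolding K_def using that assms(2) by (intro state_displacement_le) auto
    also have "K * \<tau> \<le> K * \<tau>0" using that K by simp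
    also have "K * \<tau>0 = min d1 d2 / 2" using K by (simp add: \<tau>0_def)
    also have "\<dots> < min d1 d2" using d1(1) d2(1) by (simp add: min_def)
    finally have near: "\<bar>X h l \<tau> - h\<bar> < min d1 d2" .
    have "\<bar>\<psi> (X h l \<tau>) - \<psi> h - p * (X h l \<tau> - h)\<bar> \<le> e / K * \<bar>X h l \<tau> - h\<bar>"
      using near by (intro d1(2)) simp
    also have "\<dots> \<le> e / K * (K * \<tau>)" using disp assms(3) K by (intro mult_left_mono) auto
    finally show ?thesis using near K d2(2) by simp
  qed
  moreover have "\<tau>0 > 0" using d1 d2 K by (simp add: \<tau>0_def)
  ultimately show ?thesis by blast
qed

section \<open>The viscosity inequalities\<close>

lemma hamiltonian_le_max:
  assumes "x \<in> {lmin..lmax}"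
  shows "H x h p \<le> max_H_CV \<phi> B \<sigma> \<gamma> lmin lmax h p"
  using max_H_CV_attained[OF lmin lmin_le_lmax lmax] assms by metis

text \<open>The subsolution inequality. A control that is optimal up to \<open>\<tau>\<^sup>2\<close>, an error negligible
  against \<open>\<tau>\<close>, is inserted into the dynamic programming principle, and \<open>V\<close> at the endpoint is
  replaced by the test function, which lies above it after normalisation.\<close>

lemma max_hamiltonian_ge:
  assumes h: "0 \<le> h" and \<psi>: "(\<psi> has_real_derivative p) (at h)"
    and max: "local_max_at (\<lambda>y. V y - \<psi> y) h"
  shows "\<rho> * V h \<le> max_H_CV \<phi> B \<sigma> \<gamma> lmin lmax h p"
proof (rule field_le_epsilon)
  fix e :: real assume e: "0 < e"
  define M where "M = max_H_CV \<phi> B \<sigma> \<gamma> lmin lmax h p"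
  define C where "C = short_time_error h p"
  have C: "0 \<le> C" unfolding C_def by (rule short_time_error_nonneg[OF h])
  obtain \<tau>0 where \<tau>0: "0 < \<tau>0" and touch: "\<And>\<tau> l. 0 \<le> \<tau> \<Longrightarrow> \<tau> \<le> \<tau>0 \<Longrightarrow> l \<in> A \<Longrightarrow>
     V (X h l \<tau>) - \<psi> (X h l \<tau>) \<le> V h - \<psi> h \<and>
     \<bar>\<psi> (X h l \<tau>) - \<psi> h - p * (X h l \<tau> - h)\<bar> \<le> e / 2 * \<tau>"
    using touching_neighbourhood[OF \<psi> h half_gt_zero[OF e] max[unfolded local_max_at_def]] by blast
  \<comment> \<open>The second entry absorbs the expansion error \<open>C \<tau>\<^sup>2\<close> and the suboptimality \<open>\<tau>\<^sup>2\<close>.\<close>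
  define \<tau> where "\<tau> = min \<tau>0 (e / (2 * (C + 1)))"
  have \<tau>: "0 < \<tau>" "\<tau> \<le> \<tau>0" "(C + 1) * \<tau> \<le> e / 2"
  proof -
    show "0 < \<tau>" using \<tau>0 e C by (simp add: \<tau>_def)
    show "\<tau> \<le> \<tau>0" by (simp add: \<tau>_def)
    have "(C + 1) * \<tau> \<le> (C + 1) * (e / (2 * (C + 1)))"
      using C by (intro mult_left_mono) (auto simp: \<tau>_def)
    also have "\<dots> = e / 2" using C by (simp add: field_simps add_nonneg_eq_0_iff)
    finally show "(C + 1) * \<tau> \<le> e / 2" .
  qed
  define q where "q = exp (- \<rho> * \<tau>)"
  have q: "0 < q" "q \<le> 1" using rho \<tau> by (auto simp: q_def)
  obtain l where l: "l \<in> A" and opt: "V h - \<tau> * \<tau> < J h l"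
    using near_optimal_control[of "\<tau> * \<tau>" h] \<tau> by auto
  have "V (X h l \<tau>) \<le> V h + (p * (X h l \<tau> - h) + e / 2 * \<tau>)"
    using touch[OF less_imp_le[OF \<tau>(1)] \<tau>(2) l] unfolding abs_le_iff by linarith
  then have "q * V (X h l \<tau>) \<le> q * (V h + (p * (X h l \<tau> - h) + e / 2 * \<tau>))"
    using q by (intro mult_left_mono) auto
  also have "\<dots> \<le> q * V h + q * p * (X h l \<tau> - h) + e / 2 * \<tau>"
    using q e \<tau> by (simp add: distrib_left mult.assoc)
  finally have step: "q * V (X h l \<tau>) \<le> q * V h + q * p * (X h l \<tau> - h) + e / 2 * \<tau>" .
  have "V h - \<tau> * \<tau> \<le> running_payoff h l \<tau> + q * V (X h l \<tau>)"
    using opt dynamic_programming_le[OF l h, of \<tau>] \<tau> by (simp add: q_def)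
  also have "\<dots> \<le> (running_payoff h l \<tau> + q * p * (X h l \<tau> - h)) + q * V h + e / 2 * \<tau>"
    using step by simp
  also have "\<dots> \<le> (M + C * \<tau>) * \<tau> + q * V h + e / 2 * \<tau>"
    unfolding q_def M_def C_def using \<tau>
    by (intro add_right_mono short_time_upper l h hamiltonian_le_max) auto
  finally have "(1 - q) * V h \<le> (M + (C + 1) * \<tau> + e / 2) * \<tau>"
    by (simp add: algebra_simps)
  \<comment> \<open>Since \<open>V h < 0\<close>, the upper bound \<open>1 - q \<le> \<rho> \<tau>\<close> is the one needed here.\<close>
  moreover have "\<rho> * \<tau> * V h \<le> (1 - q) * V h"
    using one_minus_exp_minus_bounds(2)[of "\<rho> * \<tau>"] rho \<tau> value_negative[OF h]
    by (intro mult_right_mono_neg) (auto simp: q_def)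
  moreover have "(M + (C + 1) * \<tau> + e / 2) * \<tau> \<le> (M + e) * \<tau>"
    using \<tau> by (intro mult_right_mono) auto
  ultimately have "(\<rho> * V h) * \<tau> \<le> (M + e) * \<tau>" by (simp add: mult_ac)
  then show "\<rho> * V h \<le> max_H_CV \<phi> B \<sigma> \<gamma> lmin lmax h p + e"
    using \<tau> by (simp add: M_def)
qed

text \<open>The supersolution inequality: every constant control \<open>x\<close> is a competitor in the dynamic
  programming principle and yields \<open>H x h p \<le> \<rho> V h\<close>.\<close>

lemma max_hamiltonian_le:
  assumes h: "0 \<le> h" and \<psi>: "(\<psi> has_real_derivative p) (at h)"
    and min: "local_min_at (\<lambda>y. V y - \<psi> y) h"
  shows "max_H_CV \<phi> B \<sigma> \<gamma> lmin lmax h p \<le> \<rho> * V h"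
  unfolding max_H_CV_def
proof (rule cSUP_least)
  fix x assume x: "x \<in> {lmin..lmax}"
  define l where "l = (\<lambda>_::real. x)"
  have l: "l \<in> A" unfolding l_def by (rule constant_admissible[OF x])
  define C where "C = short_time_error h p"
  \<comment> \<open>The summand with \<open>V h\<close> pays for replacing \<open>1 - exp (- \<rho> \<tau>)\<close> by \<open>\<rho> \<tau>\<close>: as \<open>V h < 0\<close>,
    the lower bound \<open>y - y\<^sup>2 \<le> 1 - exp (- y)\<close> is the one needed here.\<close>
  define D where "D = C + \<rho>\<^sup>2 * \<bar>V h\<bar> + 1"
  have C: "0 \<le> C" unfolding C_def by (rule short_time_error_nonneg[OF h])
  have D: "0 < D" using C by (auto simp: D_def intro!: add_nonneg_pos)
  show "H x h p \<le> \<rho> * V h"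
  proof (rule field_le_epsilon)
    fix e :: real assume e: "0 < e"
    obtain \<tau>0 where \<tau>0: "0 < \<tau>0" and touch: "\<And>\<tau>. 0 \<le> \<tau> \<Longrightarrow> \<tau> \<le> \<tau>0 \<Longrightarrow>
       V h - \<psi> h \<le> V (X h l \<tau>) - \<psi> (X h l \<tau>) \<and>
       \<bar>\<psi> (X h l \<tau>) - \<psi> h - p * (X h l \<tau> - h)\<bar> \<le> e / 2 * \<tau>"
      using touching_neighbourhood[OF \<psi> h half_gt_zero[OF e] min[unfolded local_min_at_def]] l by blast
    define \<tau> where "\<tau> = min \<tau>0 (e / (2 * D))"
    have \<tau>: "0 < \<tau>" "\<tau> \<le> \<tau>0" "D * \<tau> \<le> e / 2"
    proof -
      show "0 < \<tau>" using \<tau>0 e D by (simp add: \<tau>_def)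
      show "\<tau> \<le> \<tau>0" by (simp add: \<tau>_def)
      have "D * \<tau> \<le> D * (e / (2 * D))"
        using D by (intro mult_left_mono) (auto simp: \<tau>_def)
      also have "\<dots> = e / 2" using D by simp
      finally show "D * \<tau> \<le> e / 2" .
    qed
    define q where "q = exp (- \<rho> * \<tau>)"
    have q: "0 < q" "q \<le> 1" using rho \<tau> by (auto simp: q_def)
    have "V h + (p * (X h l \<tau> - h) - e / 2 * \<tau>) \<le> V (X h l \<tau>)"
      using touch[OF less_imp_le[OF \<tau>(1)] \<tau>(2)] unfolding abs_le_iff by linarith
    then have "q * (V h + (p * (X h l \<tau> - h) - e / 2 * \<tau>)) \<le> q * V (X h l \<tau>)"
      using q by (intro mult_left_mono) auto
    moreover have "q * V h + q * p * (X h l \<tau> - h) - e / 2 * \<tau>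
        \<le> q * (V h + (p * (X h l \<tau> - h) - e / 2 * \<tau>))"
      using q e \<tau> by (simp add: distrib_left right_diff_distrib mult.assoc)
    ultimately have step: "q * V h + q * p * (X h l \<tau> - h) - e / 2 * \<tau> \<le> q * V (X h l \<tau>)"
      by simp
    have "(H x h p - C * \<tau>) * \<tau> + q * V h - e / 2 * \<tau>
        \<le> (running_payoff h l \<tau> + q * p * (X h l \<tau> - h)) + q * V h - e / 2 * \<tau>"
      unfolding q_def C_def l_def using \<tau> x h
      by (intro add_right_mono diff_right_mono short_time_lower constant_admissible) auto
    also have "\<dots> \<le> running_payoff h l \<tau> + q * V (X h l \<tau>)" using step by simp
    also have "\<dots> \<le> V h"
      unfolding q_def using \<tau> by (intro dynamic_programming_ge l h) auto
    finally have "(H x h p - C * \<tau> - e / 2) * \<tau> \<le> (1 - q) * V h"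
      by (simp add: algebra_simps)
    also have "\<dots> \<le> (\<rho> * \<tau> - (\<rho> * \<tau>)\<^sup>2) * V h"
      using one_minus_exp_minus_bounds(3)[of "\<rho> * \<tau>"] rho \<tau> value_negative[OF h]
      by (intro mult_right_mono_neg) (auto simp: q_def)
    also have "\<dots> = (\<rho> * V h + \<rho>\<^sup>2 * \<bar>V h\<bar> * \<tau>) * \<tau>"
      using value_negative[OF h] by (simp add: power2_eq_square algebra_simps)
    finally have "H x h p - C * \<tau> - e / 2 \<le> \<rho> * V h + \<rho>\<^sup>2 * \<bar>V h\<bar> * \<tau>"
      using \<tau> by simp
    moreover have "C * \<tau> + \<rho>\<^sup>2 * \<bar>V h\<bar> * \<tau> \<le> e / 2"
      using \<tau> by (simp add: D_def distrib_right)
    ultimately show "H x h p \<le> \<rho> * V h + e" by simp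
  qed
qed (use lmin_le_lmax in auto)

lemma C1_differentiable_deriv:
  assumes "\<psi> C1_differentiable_on S" "h \<in> S"
  shows "(\<psi> has_real_derivative deriv \<psi> h) (at h)"
  using assms unfolding C1_differentiable_on_def
  by (metis DERIV_deriv_iff_real_differentiable real_differentiable_def
      has_real_derivative_iff_has_vector_derivative)

lemma value_viscosity_solution:
  "viscosity_solution \<rho> (max_H_CV \<phi> B \<sigma> \<gamma> lmin lmax) V"
proof -
  have "continuous_on {0<..} V"
    by (rule continuous_on_subset[OF value_continuous]) auto
  then show ?thesis
    unfolding viscosity_solution_def viscosity_subsolution_def viscosity_supersolution_def
    by (auto intro!: max_hamiltonian_ge max_hamiltonian_le C1_differentiable_deriv[where S = "{0<..}"])
qed

end

theorem proposition6:
  fixes \<rho> \<phi> B \<sigma> \<gamma> lmin lmax :: real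
    and V :: "real \<Rightarrow> real"
  assumes "\<rho> > 0" and "\<phi> > 0" and "B > 0"
    and "\<sigma> > 1" and "\<gamma> < 1" and "\<gamma> * (\<sigma> - 1) > 1"
    and "0 < lmin" and "lmin < lmax" and "lmax < 1"
  defines "V \<equiv> value_function \<rho> \<phi> B \<sigma> \<gamma> lmin lmax"
  shows "((\<forall>h\<ge>0. V h < 0) \<and> (\<exists>V0::real. (V \<longlongrightarrow> V0) (at_right 0)) \<and>
            strict_antimono_on {0..} V \<and> continuous_on {0..} V) \<and>
         viscosity_solution \<rho> (max_H_CV \<phi> B \<sigma> \<gamma> lmin lmax) V \<and>
         locally_Lipschitz_on {0<..} V \<and>
         filterlim V at_bot at_top"
proof -
  interpret habit_model \<rho> \<phi> B \<sigma> \<gamma> lmin lmax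
    using assms by unfold_locales auto
  show ?thesis
    unfolding V_def
    using value_negative value_limit_at_zero value_strict_antimono value_continuous
      value_viscosity_solution value_locally_lipschitz value_at_top by blast
qed

end
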